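(* Let $E(n,m)$ denote the Euler numbers of the second kind and let $W$ denote the Lambert function. Then, as formal power series in $x$ and $t$ with rational coefficients, $$\sum_{n\ge 0}\sum_{m\ge 0}E(n,m)\,\frac{x^n}{n!}\,t^m=\frac{1-t}{W\!\left(-t\,e^{(1-t)^2x-t}\right)+1}.$$
   Context: The Euler numbers of the second kind $E(n,m)$ (second-order Eulerian numbers, indexed so that the triangle begins with $E(1,1)=1$, OEIS A008517) are defined for integers $n\ge 0$ and $m\in\mathbb{Z}$ by $E(0,0)=1$, $E(0,m)=0$ for $m\ne 0$, and, for $n\ge 1$, $$E(n,m)=m\,E(n-1,m)+(2n-m)\,E(n-1,m-1).$$ In particular $E(1,1)=1$, $E(1,m)=0$ for $m\neq 1$, and for $n\ge1$, $E(n,m)=0$ unless $1\le m\le n$. The Lambert function $W$ is the solution of $W(z)e^{W(z)}=z$ with $W(0)=0$ (principal branch), regarded as the formal power series $W(z)=\sum_{n\ge 1}\frac{(-n)^{n-1}}{n!}z^n$. The series $-t\,e^{(1-t)^2x-t}\in\mathbb{Q}[[x,t]]$ has zero constant term, so it can be substituted into $W$, and $1+W(\cdot)$ is then invertible in $\mathbb{Q}[[x,t]]$. *)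

theory Defs
  imports "HOL-Computational_Algebra.Formal_Power_Series"
begin

unbundle fps_syntax

fun euler2 :: "nat \<Rightarrow> int \<Rightarrow> int" where
  "euler2 0 m = (if m = 0 then 1 else 0)"
| "euler2 (Suc n) m = m * euler2 n m + (2 * int (Suc n) - m) * euler2 n (m - 1)"

text \<open>
  The ring \<open>\<rat>[[x,t]]\<close> is represented by the type \<^typ>\<open>rat fps fps\<close>: the outer variable is \<open>t\<close> and
  the inner one is \<open>x\<close>, so that the coefficient of \<open>x^n t^m\<close> in \<open>F\<close> is \<open>F $ m $ n\<close>.
\<close>

abbreviation var_x :: "rat fps fps" where
  "var_x \<equiv> fps_const fps_X"

abbreviation var_t :: "rat fps fps" where
  "var_t \<equiv> fps_X"

definition bfps :: "(nat \<Rightarrow> nat \<Rightarrow> rat) \<Rightarrow> rat fps fps" where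
  "bfps a = Abs_fps (\<lambda>m. Abs_fps (\<lambda>n. a n m))"

text \<open>
  Substitution \<open>f(G) = \<Sum>k. f\<^sub>k G^k\<close> of a bivariate series \<open>G\<close> with zero constant term into a univariate
  series \<open>f\<close>. Such a \<open>G\<close> may still have a nonzero constant term as a series in \<open>t\<close> over \<open>\<rat>[[x]]\<close>, so
  \<^const>\<open>fps_compose\<close> does not apply. Every monomial of \<open>G^k\<close> has total degree at least \<open>k\<close>;
  hence truncating the sum at \<open>k = n + m\<close> loses nothing, as \<open>bfps_subst_nth\<close> below shows.
\<close>

definition bfps_subst :: "rat fps \<Rightarrow> rat fps fps \<Rightarrow> rat fps fps" where
  "bfps_subst f G = bfps (\<lambda>n m. \<Sum>k\<le>n + m. f $ k * (G ^ k) $ m $ n)"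

definition lambert_W :: "rat fps" where
  "lambert_W = Abs_fps (\<lambda>n. if n = 0 then 0 else (- of_nat n) ^ (n - 1) / fact n)"

lemma bfps_nth [simp]: "bfps a $ m $ n = a n m"
  by (simp add: bfps_def)

lemma bfps_power_nth_eq_0:
  fixes G :: "rat fps fps"
  assumes "G $ 0 $ 0 = 0" "n + m < k"
  shows "(G ^ k) $ m $ n = 0"
  using assms(2)
proof (induction k arbitrary: n m)
  case 0
  then show ?case by simp
next
  case (Suc k)
  have "(G $ i * (G ^ k) $ (m - i)) $ n = 0" if "i \<le> m" for i
    unfolding fps_mult_nth
  proof (rule sum.neutral, rule ballI)
    fix j assume j: "j \<in> {0..n}"
    show "G $ i $ j * (G ^ k) $ (m - i) $ (n - j) = 0"
    proof (cases "i = 0 \<and> j = 0")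
      case True
      then show ?thesis using assms(1) by simp
    next
      case False
      then have "(n - j) + (m - i) < k" using j that Suc.prems by auto
      then show ?thesis using Suc.IH by simp
    qed
  qed
  then show ?case by (simp add: fps_mult_nth[of G] fps_sum_nth)
qed

lemma bfps_subst_nth:
  assumes "G $ 0 $ 0 = 0" "n + m \<le> N"
  shows "bfps_subst f G $ m $ n = (\<Sum>k\<le>N. f $ k * (G ^ k) $ m $ n)"
  unfolding bfps_subst_def bfps_nth
  by (rule sum.mono_neutral_left) (use assms in \<open>auto simp: bfps_power_nth_eq_0\<close>)

text \<open>Division by a series with nonzero constant term is division in the ring \<open>\<rat>[[x,t]]\<close>.\<close>

lemma bfps_divide_mult:
  fixes F G :: "rat fps fps"
  assumes "G $ 0 $ 0 \<noteq> 0"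
  shows "F / G * G = F"
proof -
  have "G $ 0 * inverse (G $ 0) = 1"
    using assms by (rule inverse_mult_eq_1')
  then have "G * inverse G = 1"
    unfolding fps_inverse_def by (rule fps_right_inverse)
  moreover have "F / G = F * inverse G"
    using assms by (intro fps_divide_unit) auto
  ultimately show ?thesis by (simp add: mult.assoc mult.commute[of G])
qed

end

theory Submission
  imports Defs
begin

text \<open>
  Write \<open>F\<close> for the generating function on the left, \<open>z = -t e\<^sup>A\<close> with \<open>A = (1 - t)\<^sup>2 x - t\<close>, and
  \<open>H = W(z) + 1\<close>. The claim is \<open>F H = 1 - t\<close>. It follows from the first-order operator
  \<open>L = (1 - 2xt) \<partial>\<^sub>x - t(1 - t) \<partial>\<^sub>t\<close>, which is a derivation of \<open>\<rat>[[x,t]]\<close>.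

  The recurrence for the Euler numbers is the equation \<open>L F = t F\<close> (lemma \<open>euler_op_euler2\<close>).
  By the chain rule \<open>z\<^sub>x = (1 - t)\<^sup>2 z\<close> and \<open>t z\<^sub>t = (1 - t)(1 - 2xt) z\<close>, so \<open>L z = 0\<close> and hence
  \<open>L H = W'(z) L z = 0\<close> (lemma \<open>euler_op_lambert_W\<close>). Therefore \<open>L (F H) = t F H\<close>, and also
  \<open>L (1 - t) = t (1 - t)\<close>. A solution of \<open>L K = t K\<close> is determined by its value at \<open>x = 0\<close>
  (lemma \<open>euler_op_eq_imp_eq_0\<close>). At \<open>x = 0\<close> one has \<open>F = 1\<close>, and \<open>H = 1 - t\<close>
  because \<open>W(-t e\<^sup>-\<^sup>t) = -t\<close> (lemma \<open>lambert_W_compose\<close>). The last identity is read off from the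
  coefficients of \<open>W\<close>: the coefficient of \<open>t\<^sup>N\<close> on the left is, up to a constant factor, the
  \<open>N\<close>-th finite difference of \<open>k\<^sup>N\<^sup>-\<^sup>1\<close>, which vanishes for \<open>N \<ge> 2\<close>.
\<close>

section \<open>Partial derivatives and the chain rule\<close>

text \<open>
  The partial derivative with respect to the inner variable \<open>x\<close>. The one with respect to the outer
  variable \<open>t\<close> is \<^const>\<open>fps_deriv\<close>.
\<close>

definition deriv_x :: "rat fps fps \<Rightarrow> rat fps fps" where
  "deriv_x G = Abs_fps (\<lambda>m. fps_deriv (G $ m))"

lemma deriv_x_nth [simp]: "deriv_x G $ m = fps_deriv (G $ m)"
  by (simp add: deriv_x_def)

lemma deriv_x_add [simp]: "deriv_x (F + G) = deriv_x F + deriv_x G"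
  by (rule fps_ext) simp

lemma deriv_x_diff [simp]: "deriv_x (F - G) = deriv_x F - deriv_x G"
  by (rule fps_ext) simp

lemma deriv_x_uminus [simp]: "deriv_x (- F) = - deriv_x F"
  by (rule fps_ext) simp

lemma deriv_x_mult: "deriv_x (F * G) = F * deriv_x G + deriv_x F * G"
  by (rule fps_ext) (simp add: fps_mult_nth fps_deriv_sum sum.distrib)

lemma deriv_x_const [simp]: "deriv_x (fps_const c) = fps_const (fps_deriv c)"
  by (rule fps_ext) simp

lemma deriv_x_one [simp]: "deriv_x 1 = 0"
  using deriv_x_const[of 1] by simp

lemma deriv_x_var_t [simp]: "deriv_x var_t = 0"
  by (rule fps_ext) (simp add: fps_X_def)

text \<open>Agreement of all coefficients of total degree at most \<open>N\<close>.\<close>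

definition agree :: "nat \<Rightarrow> rat fps fps \<Rightarrow> rat fps fps \<Rightarrow> bool" where
  "agree N F G \<longleftrightarrow> (\<forall>m n. n + m \<le> N \<longrightarrow> F $ m $ n = G $ m $ n)"

lemma agree_mult_right:
  assumes "agree N F G"
  shows "agree N (F * H) (G * H)"
  using assms unfolding agree_def
  by (auto simp: fps_mult_nth fps_sum_nth intro!: sum.cong)

lemma agree_deriv_x: "agree (Suc N) F G \<Longrightarrow> agree N (deriv_x F) (deriv_x G)"
  by (auto simp: agree_def)

lemma agree_deriv_t: "agree (Suc N) F G \<Longrightarrow> agree N (fps_deriv F) (fps_deriv G)"
  by (auto simp: agree_def simp flip: fps_of_nat)

text \<open>Up to total degree \<open>N\<close>, substitution is evaluation of a polynomial.\<close>

lemma agree_subst: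
  assumes "G $ 0 $ 0 = 0"
  shows "agree N (bfps_subst f G) (\<Sum>k\<le>N. fps_const (fps_const (f $ k)) * G ^ k)"
  using bfps_subst_nth[OF assms] by (auto simp: agree_def fps_sum_nth)

text \<open>
  The chain rule for any \<open>\<rat>\<close>-linear derivation \<open>D\<close> such that the coefficients of \<open>D F\<close> up to total
  degree \<open>N\<close> depend only on those of \<open>F\<close> up to degree \<open>N + 1\<close>. The latter property reduces the
  claim to polynomials in \<open>G\<close>, where it follows from the Leibniz rule.
\<close>

lemma bfps_subst_chain_rule:
  fixes D :: "rat fps fps \<Rightarrow> rat fps fps"
  assumes add: "\<And>F G. D (F + G) = D F + D G"
    and mult: "\<And>F G. D (F * G) = F * D G + D F * G"
    and const: "\<And>c. D (fps_const (fps_const c)) = 0"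
    and local: "\<And>N F G. agree (Suc N) F G \<Longrightarrow> agree N (D F) (D G)"
    and G0: "G $ 0 $ 0 = 0"
  shows "D (bfps_subst f G) = bfps_subst (fps_deriv f) G * D G"
proof -
  have D0: "D 0 = 0" and D1: "D 1 = 0"
    using const[of 0] const[of 1] by simp_all
  have D_sum: "D (\<Sum>k\<in>A. g k) = (\<Sum>k\<in>A. D (g k))" if "finite A" for g and A :: "nat set"
    using that by (induction A rule: finite_induct) (simp_all add: D0 add)
  have D_pow: "D (G ^ Suc k) = of_nat (Suc k) * G ^ k * D G" for k
    by (induction k) (simp_all add: D1 mult algebra_simps)
  have D_scale: "D (fps_const (fps_const c) * F) = fps_const (fps_const c) * D F" for c F
    by (simp add: mult const)
  have const_of_nat: "fps_const (fps_const (of_nat k * c)) = of_nat k * fps_const (fps_const c)"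
    for k and c :: rat
    by (metis fps_const_mult fps_of_nat)
  have D_trunc: "D (\<Sum>k\<le>Suc N. fps_const (fps_const (f $ k)) * G ^ k)
      = (\<Sum>k\<le>N. fps_const (fps_const (fps_deriv f $ k)) * G ^ k) * D G" for N
  proof -
    have "D (\<Sum>k\<le>Suc N. fps_const (fps_const (f $ k)) * G ^ k)
        = (\<Sum>k\<le>Suc N. fps_const (fps_const (f $ k)) * D (G ^ k))"
      by (simp only: D_sum D_scale finite_atMost)
    also have "\<dots> = (\<Sum>k\<le>N. fps_const (fps_const (f $ Suc k)) * D (G ^ Suc k))"
      by (subst sum.atMost_Suc_shift) (simp add: D1)
    also have "\<dots> = (\<Sum>k\<le>N. fps_const (fps_const (fps_deriv f $ k)) * G ^ k) * D G"
      unfolding sum_distrib_right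
      by (intro sum.cong refl)
        (simp only: D_pow fps_deriv_nth const_of_nat mult_ac flip: Suc_eq_plus1)
    finally show ?thesis .
  qed
  have "agree N (D (bfps_subst f G)) (bfps_subst (fps_deriv f) G * D G)" for N
    using local[OF agree_subst[OF G0, of "Suc N" f]]
      agree_mult_right[OF agree_subst[OF G0, of N "fps_deriv f"], of "D G"]
    unfolding D_trunc by (simp add: agree_def)
  then show ?thesis
    by (auto simp: agree_def fps_eq_iff)
qed

lemma bfps_subst_deriv_x:
  assumes "G $ 0 $ 0 = 0"
  shows "deriv_x (bfps_subst f G) = bfps_subst (fps_deriv f) G * deriv_x G"
  by (rule bfps_subst_chain_rule) (simp_all add: assms deriv_x_mult agree_deriv_x)

lemma bfps_subst_deriv_t:
  assumes "G $ 0 $ 0 = 0"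
  shows "fps_deriv (bfps_subst f G) = bfps_subst (fps_deriv f) G * fps_deriv G"
  by (rule bfps_subst_chain_rule) (simp_all add: assms agree_deriv_t)

section \<open>Setting \<open>x\<close> to zero\<close>

text \<open>The ring homomorphism \<open>\<rat>[[x,t]] \<rightarrow> \<rat>[[t]]\<close> that sends \<open>x\<close> to \<open>0\<close>.\<close>

definition at_x0 :: "rat fps fps \<Rightarrow> rat fps" where
  "at_x0 G = Abs_fps (\<lambda>m. G $ m $ 0)"

lemma at_x0_nth [simp]: "at_x0 G $ m = G $ m $ 0"
  by (simp add: at_x0_def)

lemma at_x0_one [simp]: "at_x0 1 = 1"
  by (rule fps_ext) simp

lemma at_x0_mult: "at_x0 (F * G) = at_x0 F * at_x0 G"
  by (rule fps_ext) (simp add: fps_mult_nth fps_sum_nth)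

lemma at_x0_power: "at_x0 (G ^ k) = at_x0 G ^ k"
  by (induction k) (simp_all add: at_x0_mult)

lemma at_x0_subst:
  assumes "G $ 0 $ 0 = 0"
  shows "at_x0 (bfps_subst f G) = f oo at_x0 G"
proof (rule fps_ext)
  fix m
  have "bfps_subst f G $ m $ 0 = (\<Sum>k\<le>m. f $ k * (G ^ k) $ m $ 0)"
    by (rule bfps_subst_nth) (use assms in auto)
  also have "\<dots> = (\<Sum>k\<le>m. f $ k * (at_x0 G ^ k) $ m)"
    by (simp flip: at_x0_power)
  finally show "at_x0 (bfps_subst f G) $ m = (f oo at_x0 G) $ m"
    by (simp add: fps_compose_nth atLeast0AtMost)
qed

section \<open>The functional equation of the Lambert series\<close>

text \<open>
  The \<open>N\<close>-th finite difference of \<open>k\<^sup>j\<close> vanishes for \<open>j < N\<close>: up to the factor \<open>j!\<close>, it is the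
  coefficient of \<open>X\<^sup>j\<close> in \<open>(1 - e\<^sup>X)\<^sup>N\<close>, a series divisible by \<open>X\<^sup>N\<close>.
\<close>

lemma sum_binomial_alternating_power_eq_0:
  assumes "j < N"
  shows "(\<Sum>k\<le>N. of_nat (N choose k) * (-1) ^ k * of_nat k ^ j) = (0 :: rat)"
proof -
  have "((1 - fps_exp 1 :: rat fps) ^ N) $ j = 0"
    by (rule startsby_zero_power_prefix[rule_format]) (use assms in auto)
  moreover have "(1 - fps_exp 1 :: rat fps) ^ N
      = (\<Sum>k\<le>N. of_nat (N choose k) * ((-1) ^ k * fps_exp (of_nat k)))"
    using binomial_ring[of "- fps_exp 1 :: rat fps" 1 N]
    by (simp add: power_minus[of "fps_exp 1"] fps_exp_power_mult mult.assoc)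
  ultimately have "0 = (\<Sum>k\<le>N. (of_nat (N choose k) * ((-1) ^ k * fps_exp (of_nat k))) $ j :: rat)"
    by (simp add: fps_sum_nth)
  also have "\<dots> = (\<Sum>k\<le>N. of_nat (N choose k) * (-1) ^ k * of_nat k ^ j / fact j)"
  proof (rule sum.cong[OF refl])
    fix k
    have *: "of_nat (N choose k) * ((-1) ^ k * fps_exp (of_nat k))
      = fps_const (of_nat (N choose k) * (-1) ^ k :: rat) * fps_exp (of_nat k)"
      by (simp add: mult.assoc flip: fps_of_nat fps_const_mult fps_const_power fps_const_neg)
    show "(of_nat (N choose k) * ((-1) ^ k * fps_exp (of_nat k))) $ j
      = (of_nat (N choose k) * (-1) ^ k * of_nat k ^ j / fact j :: rat)"
      unfolding * by simp
  qed
  finally show ?thesis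
    by (simp flip: sum_divide_distrib)
qed

text \<open>
  Replacing \<open>X\<close> by \<open>-X\<close> gives \<open>W(X e\<^sup>X) = X\<close>, so that \<open>W\<close> is the compositional inverse of
  \<open>X e\<^sup>X\<close>.
\<close>

lemma lambert_W_compose: "lambert_W oo (- fps_X * fps_exp (-1)) = - fps_X"
proof (rule fps_ext)
  fix N
  have pow: "((- fps_X * fps_exp (-1)) ^ k) $ N
      = ((-1) ^ k * (- of_nat k) ^ (N - k) / fact (N - k) :: rat)"
    if "k \<le> N" for k
  proof -
    have "(- fps_X * fps_exp (-1)) ^ k
        = fps_const ((-1) ^ k :: rat) * (fps_X ^ k * fps_exp (- of_nat k))"
      by (simp add: power_minus[of "fps_X * _"] power_mult_distrib fps_exp_power_mult
          flip: fps_const_power fps_const_neg)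
    then show ?thesis
      using that by (simp add: fps_X_power_mult_nth)
  qed
  have "fact N * (lambert_W oo (- fps_X * fps_exp (-1))) $ N
      = (\<Sum>k\<le>N. fact N * (lambert_W $ k * ((-1) ^ k * (- of_nat k) ^ (N - k) / fact (N - k))))"
    unfolding fps_compose_nth atLeast0AtMost sum_distrib_left
    by (intro sum.cong refl) (simp only: pow atMost_iff)
  \<comment> \<open>The term \<open>k = 0\<close> is zero because \<open>W\<close> has no constant term. The conditional matters only for
    \<open>N \<le> 1\<close>, where \<open>0 ^ (N - 1) = 1\<close>.\<close>
  also have "\<dots> = (\<Sum>k\<le>N. (-1) ^ (N - 1) * (of_nat (N choose k) * (-1) ^ k *
      (if k = 0 then 0 else of_nat k ^ (N - 1))))"
  proof (rule sum.cong[OF refl])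
    fix k assume "k \<in> {..N}"
    then have k: "k \<le> N" by simp
    show "fact N * (lambert_W $ k * ((-1) ^ k * (- of_nat k) ^ (N - k) / fact (N - k)))
      = (-1) ^ (N - 1) * (of_nat (N choose k) * (-1) ^ k * (if k = 0 then 0 else of_nat k ^ (N - 1)))"
    proof (cases "k = 0")
      case False
      have "(- of_nat k :: rat) ^ (k - 1) * (- of_nat k) ^ (N - k) = (- of_nat k) ^ (N - 1)"
        using False k by (simp flip: power_add)
      also have "\<dots> = (-1) ^ (N - 1) * of_nat k ^ (N - 1)"
        by (rule power_minus)
      finally show ?thesis
        using False k by (simp add: lambert_W_def binomial_fact field_simps)
    qed (simp add: lambert_W_def)
  qed
  also have "\<dots> = fact N * (- fps_X :: rat fps) $ N"
  proof (cases "N \<le> 1")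
    case True
    then consider "N = 0" | "N = 1" by linarith
    then show ?thesis by cases auto
  next
    case False
    then have "(if k = 0 then 0 else of_nat k ^ (N - 1)) = (of_nat k ^ (N - 1) :: rat)" for k :: nat
      by auto
    then show ?thesis
      using False sum_binomial_alternating_power_eq_0[of "N - 1" N]
      by (simp add: fps_X_def flip: sum_distrib_left)
  qed
  finally show "(lambert_W oo (- fps_X * fps_exp (-1))) $ N = (- fps_X) $ N"
    by (simp only: mult_cancel_left fact_nonzero simp_thms)
qed

section \<open>The differential equation\<close>

text \<open>
  The derivation \<open>L = (1 - 2xt) \<partial>\<^sub>x - t(1 - t) \<partial>\<^sub>t\<close>, chosen so that \<open>L F = t F\<close> encodes the recurrence
  of the Euler numbers of the second kind.
\<close>

definition euler_op :: "rat fps fps \<Rightarrow> rat fps fps" where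
  "euler_op F = (1 - 2 * var_x * var_t) * deriv_x F - var_t * (1 - var_t) * fps_deriv F"

lemma euler_op_nth:
  "euler_op F $ m $ n = of_nat (Suc n) * F $ m $ Suc n - of_nat m * F $ m $ n
     - (if m = 0 then 0 else (2 * of_nat n - of_nat (m - 1)) * F $ (m - 1) $ n)"
proof -
  have "fps_const (fps_const 2) = (2 :: rat fps fps)"
    by (simp add: numeral_fps_const)
  then have *: "euler_op F = deriv_x F - fps_const (fps_const 2) * (var_t * (var_x * deriv_x F))
     - var_t * fps_deriv F + var_t * (var_t * fps_deriv F)"
    by (simp add: euler_op_def algebra_simps)
  show ?thesis
    unfolding * by (cases m; cases n) (auto simp: algebra_simps simp flip: fps_of_nat)
qed

text \<open>
  In \<open>L F = t F\<close> the coefficients of \<open>x\<^sup>n\<close> determine those of \<open>x\<^bsup>n+1\<^esup>\<close>; by linearity,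
  uniqueness for a given value at \<open>x = 0\<close> is the following statement.
\<close>

lemma euler_op_eq_imp_eq_0:
  assumes eq: "euler_op F = var_t * F" and init: "at_x0 F = 0"
  shows "F = 0"
proof -
  have "F $ m $ n = 0" for m n
  proof (induction n arbitrary: m)
    case 0
    show ?case using init by (simp add: fps_eq_iff)
  next
    case (Suc n)
    have "euler_op F $ m $ n = (var_t * F) $ m $ n" by (simp add: eq)
    then have "of_nat (Suc n) * F $ m $ Suc n = 0"
      by (simp add: euler_op_nth Suc.IH del: of_nat_Suc split: if_splits)
    then show ?case by (simp del: of_nat_Suc)
  qed
  then show ?thesis by (simp add: fps_eq_iff)
qed

lemma euler_op_mult: "euler_op (F * G) = F * euler_op G + euler_op F * G"
  by (simp add: euler_op_def deriv_x_mult algebra_simps)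

lemma euler2_neg: "m < 0 \<Longrightarrow> euler2 n m = 0"
  by (induction n arbitrary: m) auto

lemma euler_op_euler2:
  fixes F
  defines "F \<equiv> bfps (\<lambda>n m. of_int (euler2 n (int m)) / fact n)"
  shows "euler_op F = var_t * F"
proof -
  have fact_Suc_cancel: "of_nat (Suc n) * (c / fact (Suc n)) = c / fact n" for n and c :: rat
    by (simp del: of_nat_Suc)
  have "euler_op F $ m $ n = (var_t * F) $ m $ n" for m n
    unfolding euler_op_nth F_def bfps_nth fact_Suc_cancel
    by (cases m) (auto simp: euler2_neg field_simps)
  then show ?thesis by (simp add: fps_eq_iff)
qed

lemma euler_op_lambert_W:
  fixes z
  defines "z \<equiv> - var_t * bfps_subst (fps_exp 1) ((1 - var_t)\<^sup>2 * var_x - var_t)"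
  shows "euler_op (bfps_subst lambert_W z + 1) = 0"
proof -
  define A :: "rat fps fps" where "A = (1 - var_t)\<^sup>2 * var_x - var_t"
  have A0: "A $ 0 $ 0 = 0" by (simp add: A_def)
  have Ax: "deriv_x A = (1 - var_t)\<^sup>2"
    by (simp add: A_def power2_eq_square deriv_x_mult)
  have At: "fps_deriv A = - 2 * (1 - var_t) * var_x - 1"
    by (simp add: A_def power2_eq_square algebra_simps)
  have z: "z = - var_t * bfps_subst (fps_exp 1) A" and z0: "z $ 0 $ 0 = 0"
    by (simp_all add: z_def A_def)
  have zx: "deriv_x z = (1 - var_t)\<^sup>2 * z"
    by (simp add: z deriv_x_mult bfps_subst_deriv_x A0 Ax)
  have zt: "var_t * fps_deriv z = (1 - var_t) * (1 - 2 * var_x * var_t) * z"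
    by (simp add: z bfps_subst_deriv_t A0 At algebra_simps)
  have "euler_op (bfps_subst lambert_W z + 1)
      = bfps_subst (fps_deriv lambert_W) z * ((1 - 2 * var_x * var_t) * deriv_x z
          - (1 - var_t) * (var_t * fps_deriv z))"
    by (simp add: euler_op_def bfps_subst_deriv_x bfps_subst_deriv_t z0 algebra_simps)
  also have "(1 - 2 * var_x * var_t) * deriv_x z - (1 - var_t) * (var_t * fps_deriv z) = 0"
    unfolding zx zt by (simp add: power2_eq_square mult_ac)
  finally show ?thesis by simp
qed

section \<open>The generating function\<close>

theorem theorem2:
  shows "bfps (\<lambda>n m. of_int (euler2 n (int m)) / fact n)
       = (1 - var_t) /
         (bfps_subst lambert_W
            (- var_t * bfps_subst (fps_exp 1) ((1 - var_t)\<^sup>2 * var_x - var_t)) + 1)"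
proof -
  define F :: "rat fps fps" where "F = bfps (\<lambda>n m. of_int (euler2 n (int m)) / fact n)"
  define A :: "rat fps fps" where "A = (1 - var_t)\<^sup>2 * var_x - var_t"
  define z where "z = - var_t * bfps_subst (fps_exp 1) A"
  define H where "H = bfps_subst lambert_W z + 1"
  have A0: "A $ 0 $ 0 = 0" and z0: "z $ 0 $ 0 = 0" by (simp_all add: A_def z_def)
  have H00: "H $ 0 $ 0 \<noteq> 0"
    by (simp add: H_def bfps_subst_def lambert_W_def)
  have "at_x0 A = - fps_X"
    by (simp add: fps_eq_iff A_def fps_X_def)
  then have "at_x0 (bfps_subst (fps_exp 1) A) = fps_exp (-1)"
    by (simp add: at_x0_subst A0 fps_compose_uminus' fps_exp_def)
  moreover have "at_x0 (- var_t) = - fps_X"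
    by (simp add: fps_eq_iff fps_X_def)
  ultimately have z_init: "at_x0 z = - fps_X * fps_exp (-1)"
    unfolding z_def at_x0_mult by simp
  have W_init: "at_x0 (bfps_subst lambert_W z) = - fps_X"
    unfolding at_x0_subst[OF z0] z_init by (rule lambert_W_compose)
  have H_init: "at_x0 H = 1 - fps_X"
    using W_init unfolding H_def fps_eq_iff at_x0_nth by simp
  have F_init: "at_x0 F = 1"
    by (simp add: fps_eq_iff F_def)
  have "euler_op F = var_t * F"
    unfolding F_def by (rule euler_op_euler2)
  moreover have "euler_op H = 0"
    unfolding H_def z_def A_def by (rule euler_op_lambert_W)
  ultimately have FH: "euler_op (F * H) = var_t * (F * H)"
    by (simp add: euler_op_mult)
  have one_t: "euler_op (1 - var_t) = var_t * (1 - var_t)"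
    by (simp add: euler_op_def)
  have "euler_op (F * H - (1 - var_t)) = euler_op (F * H) - euler_op (1 - var_t)"
    by (simp add: euler_op_def algebra_simps)
  then have "euler_op (F * H - (1 - var_t)) = var_t * (F * H - (1 - var_t))"
    by (simp add: FH one_t right_diff_distrib)
  moreover have "at_x0 (F * H - (1 - var_t)) = 0"
  proof -
    have "at_x0 (F * H - (1 - var_t)) = at_x0 (F * H) - at_x0 (1 - var_t)"
      by (simp add: fps_eq_iff)
    also have "at_x0 (1 - var_t) = 1 - fps_X"
      by (simp add: fps_eq_iff fps_X_def)
    finally show ?thesis
      by (simp add: at_x0_mult F_init H_init)
  qed
  ultimately have "F * H = 1 - var_t"
    using euler_op_eq_imp_eq_0[of "F * H - (1 - var_t)"] by simp
  also have "\<dots> = (1 - var_t) / H * H"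
    using H00 by (simp add: bfps_divide_mult)
  finally have "F = (1 - var_t) / H"
    using H00 by (auto simp: mult_cancel_right)
  then show ?thesis
    by (simp add: F_def H_def z_def A_def)
qed

end
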